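(* Let $\pi:[0,T_\pi]\to\mathcal{X}$ be an admissible trajectory (i.e. $\pi\in\Pi(x,y)$ for some $x,y\in\mathcal{X}$) and let $\tau\in(0,T_\pi)$ be such that $\mathrm{clr}(\pi(\tau))<\infty$. Then the one-sided limits below exist in $[0,\infty]$ and $$\lim_{t\to\tau^-}\mathrm{clr}(\pi(t))\ \le\ \mathrm{clr}(\pi(\tau))\ \le\ \lim_{t\to\tau^+}\mathrm{clr}(\pi(t)).$$
   Context: Setting. $\mathcal{X}\subseteq\mathbb{R}^n$ (state space) is a linear subspace with inner product $\langle\cdot,\cdot\rangle$ and norm $\|\cdot\|$; $B_r(x)=\{y\in\mathcal{X}:\|x-y\|<r\}$. $F:\mathcal{X}\rightrightarrows\mathcal{X}$ is a set-valued map (the admissible velocities $F(x)=\{f(x,u):u\in\mathcal{U}\}$ of a control system) satisfying: (SH1) each $F(x)$ is nonempty and convex, the graph $\{(x,v):v\in F(x)\}$ is closed in $\mathcal{X}^2$, and for each compact $K\subset\mathcal{X}$ there is $M>0$ with $\|v\|\le M$ whenever $x\in K$, $v\in F(x)$; (SH2) there are $\gamma,c>0$ with $\|v\|\le\gamma\|x\|+c$ for all $x\in\mathcal{X}$, $v\in F(x)$; (SH3) for each compact $K\subset\mathcal{X}$ there is $k>0$ with $F(x)\subseteq F(y)+k\|x-y\|\overline{B_1(0)}$ for all $x,y\in K$. The running cost $\psi:\mathcal{X}^2\to(0,\infty)$ is continuous. Obstacles and trajectories. $\mathcal{O}\subset\mathcal{X}$ is a closed set (obstacle), $\mathcal{X}_{\mathrm{free}}:=\mathcal{X}\setminus\mathcal{O}$.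 $\Pi(x,y)$ is the set of absolutely continuous $\pi:[0,T_\pi]\to\mathcal{X}$ (some $T_\pi\ge0$) with $\dot\pi(t)\in F(\pi(t))$ for a.e. $t$, $\pi(0)=x$, $\pi(T_\pi)=y$, and $\pi(t)\in\overline{\mathcal{X}_{\mathrm{free}}}$ for all $t\in[0,T_\pi]$. The cost of $\pi$ is $c_\pi:=\int_0^{T_\pi}\psi(\pi(t),\dot\pi(t))\,dt$. Derived notions. $d_c(x,y):=\inf\{c_\pi:\pi\in\Pi(x,y)\}$ ($=\infty$ if $\Pi(x,y)=\emptyset$); clearance $\mathrm{clr}(x):=\inf_{y\in\mathcal{O}}d_c(x,y)\in[0,\infty]$. *)

theory Defs
  imports "HOL-Analysis.Analysis"
begin

text \<open>The state space is a linear subspace \<open>X\<close> of a Euclidean space \<open>'a\<close>, carrying the induced inner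
  product. Functions on \<open>X\<close> are total on \<open>'a\<close> but only constrained on \<open>X\<close>. As \<open>X\<close> is closed in \<open>'a\<close>,
  closedness, closure and compactness of subsets of \<open>X\<close> mean the same in \<open>X\<close> as in \<open>'a\<close>.\<close>

definition SH1 :: "'a::euclidean_space set \<Rightarrow> ('a \<Rightarrow> 'a set) \<Rightarrow> bool" where
  "SH1 X F \<longleftrightarrow>
     (\<forall>x\<in>X. F x \<noteq> {} \<and> convex (F x)) \<and>
     closed {(x, v). x \<in> X \<and> v \<in> F x} \<and>
     (\<forall>K. compact K \<and> K \<subseteq> X \<longrightarrow> (\<exists>M>0. \<forall>x\<in>K. \<forall>v\<in>F x. norm v \<le> M))"

definition SH2 :: "'a::euclidean_space set \<Rightarrow> ('a \<Rightarrow> 'a set) \<Rightarrow> bool" where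
  "SH2 X F \<longleftrightarrow> (\<exists>\<gamma>>0. \<exists>c>0. \<forall>x\<in>X. \<forall>v\<in>F x. norm v \<le> \<gamma> * norm x + c)"

definition SH3 :: "'a::euclidean_space set \<Rightarrow> ('a \<Rightarrow> 'a set) \<Rightarrow> bool" where
  "SH3 X F \<longleftrightarrow>
     (\<forall>K. compact K \<and> K \<subseteq> X \<longrightarrow>
        (\<exists>k>0. \<forall>x\<in>K. \<forall>y\<in>K.
           F x \<subseteq> {w + (k * norm (x - y)) *\<^sub>R b | w b. w \<in> F y \<and> b \<in> cball 0 1 \<inter> X}))"

text \<open>Absolute continuity of a curve in the usual \<open>\<epsilon>\<close>-\<open>\<delta>\<close> sense; a pair \<open>(a, b)\<close> in \<open>I\<close> stands for the
  interval with endpoints \<open>a \<le> b\<close>. (The library's constant \<open>absolutely_continuous\<close> is about measures.)\<close>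

definition abs_continuous_on :: "real set \<Rightarrow> (real \<Rightarrow> 'a::real_normed_vector) \<Rightarrow> bool" where
  "abs_continuous_on S f \<longleftrightarrow>
     (\<forall>\<epsilon>>0. \<exists>\<delta>>0. \<forall>I :: (real \<times> real) set.
        finite I \<and>
        (\<forall>(a, b)\<in>I. a \<le> b \<and> {a..b} \<subseteq> S) \<and>
        pairwise (\<lambda>(a, b) (c, d). {a<..<b} \<inter> {c<..<d} = {}) I \<and>
        (\<Sum>(a, b)\<in>I. b - a) < \<delta>
        \<longrightarrow> (\<Sum>(a, b)\<in>I. norm (f b - f a)) < \<epsilon>)"

text \<open>A trajectory is a pair \<open>(T, \<pi>)\<close>; only the values of \<open>\<pi>\<close> on \<open>{0..T}\<close> matter. \<open>Ob\<close> is the obstacle.\<close>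

definition trajectories ::
    "'a::euclidean_space set \<Rightarrow> ('a \<Rightarrow> 'a set) \<Rightarrow> 'a set \<Rightarrow> 'a \<Rightarrow> 'a \<Rightarrow> (real \<times> (real \<Rightarrow> 'a)) set" where
  "trajectories X F Ob x y =
     {(T, \<pi>). 0 \<le> T \<and>
        (\<forall>t\<in>{0..T}. \<pi> t \<in> X) \<and>
        abs_continuous_on {0..T} \<pi> \<and>
        (AE t\<in>{0..T} in lebesgue.
           \<exists>v\<in>F (\<pi> t). (\<pi> has_vector_derivative v) (at t within {0..T})) \<and>
        \<pi> 0 = x \<and> \<pi> T = y \<and>
        (\<forall>t\<in>{0..T}. \<pi> t \<in> closure (X - Ob))}"

definition cost :: "('a::euclidean_space \<times> 'a \<Rightarrow> real) \<Rightarrow> real \<Rightarrow> (real \<Rightarrow> 'a) \<Rightarrow> ennreal" where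
  "cost \<psi> T \<pi> =
     (\<integral>\<^sup>+t\<in>{0..T}. ennreal (\<psi> (\<pi> t, vector_derivative \<pi> (at t within {0..T}))) \<partial>lebesgue)"

definition cost_dist ::
    "'a::euclidean_space set \<Rightarrow> ('a \<Rightarrow> 'a set) \<Rightarrow> ('a \<times> 'a \<Rightarrow> real) \<Rightarrow> 'a set \<Rightarrow> 'a \<Rightarrow> 'a \<Rightarrow> ennreal" where
  "cost_dist X F \<psi> Ob x y = (INF (T, \<pi>)\<in>trajectories X F Ob x y. cost \<psi> T \<pi>)"

definition clearance ::
    "'a::euclidean_space set \<Rightarrow> ('a \<Rightarrow> 'a set) \<Rightarrow> ('a \<times> 'a \<Rightarrow> real) \<Rightarrow> 'a set \<Rightarrow> 'a \<Rightarrow> ennreal" where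
  "clearance X F \<psi> Ob x = (INF y\<in>Ob. cost_dist X F \<psi> Ob x y)"

end

theory Submission
  imports Defs
begin

text \<open>Following \<open>\<pi>\<close> from \<open>\<pi> s\<close> to \<open>\<pi> t\<close> and then an almost optimal trajectory from \<open>\<pi> t\<close> to the obstacle
  shows that the clearance at \<open>\<pi> s\<close> exceeds that at \<open>\<pi> t\<close> by at most the cost of \<open>\<pi>\<close> on \<open>[s, t]\<close>. That cost
  is at most \<open>M (t - s)\<close>, where \<open>M\<close> bounds the running cost along \<open>\<pi>\<close>. Hence the clearance at \<open>\<pi> t\<close> plus
  \<open>M t\<close> is nondecreasing in \<open>t\<close>, has one-sided limits, and these enclose its value.\<close>

section \<open>Absolutely continuous curves\<close>

lemma abs_continuous_on_subset:
  assumes "abs_continuous_on S f" "R \<subseteq> S"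
  shows "abs_continuous_on R f"
  unfolding abs_continuous_on_def
proof (intro allI impI)
  fix \<epsilon> :: real assume "\<epsilon> > 0"
  with assms(1) obtain \<delta> where "\<delta> > 0" and \<delta>: "\<And>I. finite I \<Longrightarrow> (\<forall>(a, b)\<in>I. a \<le> b \<and> {a..b} \<subseteq> S) \<Longrightarrow>
      pairwise (\<lambda>(a, b) (c, d). {a<..<b} \<inter> {c<..<d} = {}) I \<Longrightarrow>
      (\<Sum>(a, b)\<in>I. b - a) < \<delta> \<Longrightarrow> (\<Sum>(a, b)\<in>I. norm (f b - f a)) < \<epsilon>"
    unfolding abs_continuous_on_def by meson
  show "\<exists>\<delta>>0. \<forall>I. finite I \<and> (\<forall>(a, b)\<in>I. a \<le> b \<and> {a..b} \<subseteq> R) \<and>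
      pairwise (\<lambda>(a, b) (c, d). {a<..<b} \<inter> {c<..<d} = {}) I \<and>
      (\<Sum>(a, b)\<in>I. b - a) < \<delta> \<longrightarrow> (\<Sum>(a, b)\<in>I. norm (f b - f a)) < \<epsilon>"
  proof (intro exI[of _ \<delta>] conjI allI impI \<open>\<delta> > 0\<close>; elim conjE)
    fix I :: "(real \<times> real) set"
    assume I: "finite I" "\<forall>(a, b)\<in>I. a \<le> b \<and> {a..b} \<subseteq> R"
      "pairwise (\<lambda>(a, b) (c, d). {a<..<b} \<inter> {c<..<d} = {}) I" "(\<Sum>(a, b)\<in>I. b - a) < \<delta>"
    have "\<forall>(a, b)\<in>I. a \<le> b \<and> {a..b} \<subseteq> S"
      using I(2) assms(2) by blast
    with I show "(\<Sum>(a, b)\<in>I. norm (f b - f a)) < \<epsilon>"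
      by (intro \<delta>)
  qed
qed

lemma abs_continuous_on_cong:
  assumes "abs_continuous_on S f" "\<And>t. t \<in> S \<Longrightarrow> g t = f t"
  shows "abs_continuous_on S g"
proof -
  have "(\<Sum>(a, b)\<in>I. norm (g b - g a)) = (\<Sum>(a, b)\<in>I. norm (f b - f a))"
    if "\<forall>(a, b)\<in>I. a \<le> b \<and> {a..b} \<subseteq> S" for I
  proof (rule sum.cong[OF refl], clarify)
    fix a b assume "(a, b) \<in> I"
    with that have "a \<in> S" "b \<in> S" by fastforce+
    then show "norm (g b - g a) = norm (f b - f a)" by (simp add: assms(2))
  qed
  with assms(1) show ?thesis
    unfolding abs_continuous_on_def by (metis (no_types, lifting))
qed

text \<open>Translating every interval of a family by \<open>-c\<close> keeps lengths and
  disjointness, so the \<delta> found for \<open>f\<close> serves unchanged.\<close>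

lemma abs_continuous_on_shift:
  assumes "abs_continuous_on {a..b} f"
  shows "abs_continuous_on {a + c..b + c} (\<lambda>t. f (t - c))"
  unfolding abs_continuous_on_def
proof (intro allI impI)
  fix \<epsilon> :: real assume "\<epsilon> > 0"
  with assms(1) obtain \<delta> where "\<delta> > 0" and \<delta>: "\<And>I. finite I \<Longrightarrow> (\<forall>(u, v)\<in>I. u \<le> v \<and> {u..v} \<subseteq> {a..b}) \<Longrightarrow>
      pairwise (\<lambda>(u, v) (u', v'). {u<..<v} \<inter> {u'<..<v'} = {}) I \<Longrightarrow>
      (\<Sum>(u, v)\<in>I. v - u) < \<delta> \<Longrightarrow> (\<Sum>(u, v)\<in>I. norm (f v - f u)) < \<epsilon>"
    unfolding abs_continuous_on_def by meson
  have "(\<Sum>(u, v)\<in>I. norm (f (v - c) - f (u - c))) < \<epsilon>"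
    if I: "finite I" "\<forall>(u, v)\<in>I. u \<le> v \<and> {u..v} \<subseteq> {a + c..b + c}"
      "pairwise (\<lambda>(u, v) (u', v'). {u<..<v} \<inter> {u'<..<v'} = {}) I" "(\<Sum>(u, v)\<in>I. v - u) < \<delta>" for I
  proof -
    define sh where "sh = (\<lambda>(u, v). (u - c, v - c))"
    have inj: "inj_on sh I"
      by (auto simp: inj_on_def sh_def)
    have "(\<Sum>(u, v)\<in>sh ` I. norm (f v - f u)) < \<epsilon>"
    proof (rule \<delta>)
      show "finite (sh ` I)" using I by simp
      show "\<forall>(u, v)\<in>sh ` I. u \<le> v \<and> {u..v} \<subseteq> {a..b}"
        using I(2) by (fastforce simp: sh_def)
      show "pairwise (\<lambda>(u, v) (u', v'). {u<..<v} \<inter> {u'<..<v'} = {}) (sh ` I)"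
        unfolding pairwise_image
        \<comment> \<open>Two open intervals intersect in the interval from a maximum to a minimum;
          the shift is pulled out of both, so emptiness is preserved.\<close>
        by (rule pairwise_mono[OF I(3) _ order_refl])
          (simp add: sh_def case_prod_unfold flip: max_diff_distrib_left min_diff_distrib_left)
      show "(\<Sum>(u, v)\<in>sh ` I. v - u) < \<delta>"
        using I(4) unfolding sum.reindex[OF inj] by (simp add: sh_def case_prod_unfold)
    qed
    then show ?thesis
      unfolding sum.reindex[OF inj] by (simp add: sh_def case_prod_unfold)
  qed
  then show "\<exists>\<delta>>0. \<forall>I. finite I \<and> (\<forall>(u, v)\<in>I. u \<le> v \<and> {u..v} \<subseteq> {a + c..b + c}) \<and>
      pairwise (\<lambda>(u, v) (u', v'). {u<..<v} \<inter> {u'<..<v'} = {}) I \<and>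
      (\<Sum>(u, v)\<in>I. v - u) < \<delta> \<longrightarrow> (\<Sum>(u, v)\<in>I. norm (f (v - c) - f (u - c))) < \<epsilon>"
    using \<open>\<delta> > 0\<close> by (intro exI[of _ \<delta>]) blast
qed

text \<open>Degenerate intervals contribute nothing, and the remaining ones in a non-overlapping family are
  determined by either endpoint. Clipping the family to one side of a point is therefore injective.\<close>

lemma sum_clip_less:
  fixes f :: "real \<Rightarrow> 'a::real_normed_vector" and p q :: "real \<Rightarrow> real"
  assumes \<delta>: "\<And>I. finite I \<Longrightarrow> (\<forall>(u, v)\<in>I. u \<le> v \<and> {u..v} \<subseteq> S) \<Longrightarrow>
      pairwise (\<lambda>(u, v) (u', v'). {u<..<v} \<inter> {u'<..<v'} = {}) I \<Longrightarrow>
      (\<Sum>(u, v)\<in>I. v - u) < \<delta> \<Longrightarrow> (\<Sum>(u, v)\<in>I. norm (f v - f u)) < \<epsilon>"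
    and I: "finite I" "\<forall>(u, v)\<in>I. u \<le> v"
      "pairwise (\<lambda>(u, v) (u', v'). {u<..<v} \<inter> {u'<..<v'} = {}) I" "(\<Sum>(u, v)\<in>I. v - u) < \<delta>"
    and p: "\<And>u v. (u, v) \<in> I \<Longrightarrow> p u < p v \<Longrightarrow> {p u..p v} \<subseteq> S \<and> {p u..p v} \<subseteq> {u..v}"
    and mono: "mono p"
  shows "(\<Sum>(u, v)\<in>I. norm (f (p v) - f (p u))) < \<epsilon>"
proof -
  define J where "J = {(u, v)\<in>I. p u < p v}"
  define cl where "cl = (\<lambda>(u, v). (p u, p v))"
  have JI: "J \<subseteq> I" "finite J"
    using I(1) by (auto simp: J_def intro: finite_subset)
  have clip: "{p u<..<p v} \<subseteq> {u<..<v}" if "(u, v) \<in> J" for u v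
    using p[of u v] that unfolding J_def by (simp add: subset_iff) (smt (verit))
  have disj: "{u<..<v} \<inter> {u'<..<v'} = {}"
    if "(u, v) \<in> J" "(u', v') \<in> J" "(u, v) \<noteq> (u', v')" for u v u' v'
    using I(3) JI(1) that by (fastforce dest: pairwiseD)
  \<comment> \<open>Two members with the same image share a point inside it. By \<open>clip\<close>
    that point lies in both original open intervals, so disjointness forces the members to
    coincide.\<close>
  have inj: "inj_on cl J"
  proof (rule inj_onI)
    fix i j assume "i \<in> J" "j \<in> J" "cl i = cl j"
    moreover obtain u v u' v' where ij: "i = (u, v)" "j = (u', v')" by fastforce
    ultimately have J: "(u, v) \<in> J" "(u', v') \<in> J" and "cl (u, v) = cl (u', v')" by simp_all
    then have eq: "p u = p u'" "p v = p v'" by (auto simp: cl_def)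
    have "p u < p v" using J by (auto simp: J_def)
    then obtain m where "m \<in> {p u<..<p v}" using dense by auto
    then have "m \<in> {u<..<v} \<inter> {u'<..<v'}"
      using clip[OF J(1)] clip[OF J(2)] eq by auto
    then show "i = j"
      using disj[OF J] unfolding ij by blast
  qed
  have sub: "p v - p u \<le> v - u" if "(u, v) \<in> J" for u v
  proof -
    have "{p u..p v} \<subseteq> {u..v}" "p u < p v" using p[of u v] that by (auto simp: J_def)
    then show ?thesis by simp
  qed
  have "(\<Sum>(u, v)\<in>I. norm (f (p v) - f (p u))) = (\<Sum>(u, v)\<in>J. norm (f (p v) - f (p u)))"
  \<comment> \<open>Outside \<open>J\<close>, monotonicity gives \<open>p u = p v\<close>, so the
    increment of \<open>f\<close> vanishes.\<close>
  proof (rule sum.mono_neutral_right[OF I(1) JI(1)], clarify)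
    fix u v assume "(u, v) \<in> I" "(u, v) \<notin> J"
    then have "p v \<le> p u" "p u \<le> p v"
      using I(2) monoD[OF mono, of u v] by (auto simp: J_def)
    then show "norm (f (p v) - f (p u)) = 0" by simp
  qed
  also have "\<dots> = (\<Sum>(u, v)\<in>cl ` J. norm (f v - f u))"
    unfolding sum.reindex[OF inj] by (simp add: cl_def case_prod_unfold)
  also have "\<dots> < \<epsilon>"
  proof (rule \<delta>)
    show "finite (cl ` J)" using JI by simp
    show "\<forall>(u, v)\<in>cl ` J. u \<le> v \<and> {u..v} \<subseteq> S"
      using p JI(1) by (fastforce simp: cl_def J_def)
    show "pairwise (\<lambda>(u, v) (u', v'). {u<..<v} \<inter> {u'<..<v'} = {}) (cl ` J)"
    proof (rule pairwiseI)
      fix i j assume "i \<in> cl ` J" "j \<in> cl ` J" "i \<noteq> j"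
      then obtain r s where rs: "r \<in> J" "s \<in> J" "i = cl r" "j = cl s" "r \<noteq> s"
        by blast
      obtain u v u' v' where uv: "r = (u, v)" "s = (u', v')"
        by fastforce
      with rs have J: "(u, v) \<in> J" "(u', v') \<in> J" and "(u, v) \<noteq> (u', v')"
        and ij: "i = (p u, p v)" "j = (p u', p v')"
        by (auto simp: cl_def)
      then have "{u<..<v} \<inter> {u'<..<v'} = {}" by (intro disj)
      then have "{p u<..<p v} \<inter> {p u'<..<p v'} = {}"
        using clip[OF J(1)] clip[OF J(2)] by blast
      then show "(case i of (u, v) \<Rightarrow> \<lambda>(u', v'). {u<..<v} \<inter> {u'<..<v'} = {}) j"
        unfolding ij by simp
    qed
    have "(\<Sum>(u, v)\<in>cl ` J. v - u) = (\<Sum>(u, v)\<in>J. p v - p u)"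
      unfolding sum.reindex[OF inj] by (simp add: cl_def case_prod_unfold)
    also have "\<dots> \<le> (\<Sum>(u, v)\<in>J. v - u)"
      using sub by (intro sum_mono) auto
    also have "\<dots> \<le> (\<Sum>(u, v)\<in>I. v - u)"
      using I(2) by (intro sum_mono2[OF I(1) JI(1)]) auto
    finally show "(\<Sum>(u, v)\<in>cl ` J. v - u) < \<delta>"
      using I(4) by simp
  qed
  finally show ?thesis .
qed

text \<open>Clip a family at \<open>b\<close> from both sides with \<open>min _ b\<close> and
  \<open>max _ b\<close>. Each clipped sum is below \<epsilon>/2, and every increment of
  \<open>f\<close> is the sum of its two clipped increments.\<close>

lemma abs_continuous_on_join:
  fixes f :: "real \<Rightarrow> 'a::real_normed_vector"
  assumes "abs_continuous_on {a..b} f" "abs_continuous_on {b..c} f"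
  shows "abs_continuous_on {a..c} f"
  unfolding abs_continuous_on_def
proof (intro allI impI)
  fix \<epsilon> :: real assume "\<epsilon> > 0"
  then have half: "\<epsilon> / 2 > 0" by simp
  from assms(1) half obtain \<delta>1 where "\<delta>1 > 0" and \<delta>1: "\<And>I. finite I \<Longrightarrow> (\<forall>(u, v)\<in>I. u \<le> v \<and> {u..v} \<subseteq> {a..b}) \<Longrightarrow>
      pairwise (\<lambda>(u, v) (u', v'). {u<..<v} \<inter> {u'<..<v'} = {}) I \<Longrightarrow>
      (\<Sum>(u, v)\<in>I. v - u) < \<delta>1 \<Longrightarrow> (\<Sum>(u, v)\<in>I. norm (f v - f u)) < \<epsilon> / 2"
    unfolding abs_continuous_on_def by meson
  from assms(2) half obtain \<delta>2 where "\<delta>2 > 0" and \<delta>2: "\<And>I. finite I \<Longrightarrow> (\<forall>(u, v)\<in>I. u \<le> v \<and> {u..v} \<subseteq> {b..c}) \<Longrightarrow>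
      pairwise (\<lambda>(u, v) (u', v'). {u<..<v} \<inter> {u'<..<v'} = {}) I \<Longrightarrow>
      (\<Sum>(u, v)\<in>I. v - u) < \<delta>2 \<Longrightarrow> (\<Sum>(u, v)\<in>I. norm (f v - f u)) < \<epsilon> / 2"
    unfolding abs_continuous_on_def by meson
  have "(\<Sum>(u, v)\<in>I. norm (f v - f u)) < \<epsilon>"
    if I: "finite I" "\<forall>(u, v)\<in>I. u \<le> v \<and> {u..v} \<subseteq> {a..c}"
      "pairwise (\<lambda>(u, v) (u', v'). {u<..<v} \<inter> {u'<..<v'} = {}) I"
      "(\<Sum>(u, v)\<in>I. v - u) < min \<delta>1 \<delta>2" for I
  proof -
    have ord: "\<forall>(u, v)\<in>I. u \<le> v" using I(2) by auto
    have bd: "a \<le> u" "u \<le> v" "v \<le> c" if "(u, v) \<in> I" for u v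
      using I(2) that by fastforce+
    have 1: "(\<Sum>(u, v)\<in>I. norm (f (min v b) - f (min u b))) < \<epsilon> / 2"
      using I(4) by (intro sum_clip_less[where S = "{a..b}", OF \<delta>1 I(1) ord I(3)])
        (auto simp: mono_def dest: bd)
    have 2: "(\<Sum>(u, v)\<in>I. norm (f (max v b) - f (max u b))) < \<epsilon> / 2"
      using I(4) by (intro sum_clip_less[where S = "{b..c}", OF \<delta>2 I(1) ord I(3)])
        (auto simp: mono_def dest: bd)
    have "(\<Sum>(u, v)\<in>I. norm (f v - f u)) \<le>
        (\<Sum>(u, v)\<in>I. norm (f (min v b) - f (min u b)) + norm (f (max v b) - f (max u b)))"
    proof (rule sum_mono, clarify)
      fix u v assume "(u, v) \<in> I"
      then have "u \<le> v" by (rule bd)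
      \<comment> \<open>If \<open>b\<close> is not strictly between \<open>u\<close> and
        \<open>v\<close>, one bracket is zero; otherwise the brackets telescope through
        \<open>f b\<close>.\<close>
      then have "f v - f u = (f (min v b) - f (min u b)) + (f (max v b) - f (max u b))"
        by (auto simp: min_def max_def)
      then show "norm (f v - f u) \<le> norm (f (min v b) - f (min u b)) + norm (f (max v b) - f (max u b))"
        by (metis norm_triangle_ineq)
    qed
    also have "\<dots> = (\<Sum>(u, v)\<in>I. norm (f (min v b) - f (min u b))) + (\<Sum>(u, v)\<in>I. norm (f (max v b) - f (max u b)))"
      by (simp add: sum.distrib case_prod_unfold)
    finally show ?thesis using 1 2 by linarith
  qed
  then show "\<exists>\<delta>>0. \<forall>I. finite I \<and> (\<forall>(u, v)\<in>I. u \<le> v \<and> {u..v} \<subseteq> {a..c}) \<and>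
      pairwise (\<lambda>(u, v) (u', v'). {u<..<v} \<inter> {u'<..<v'} = {}) I \<and>
      (\<Sum>(u, v)\<in>I. v - u) < \<delta> \<longrightarrow> (\<Sum>(u, v)\<in>I. norm (f v - f u)) < \<epsilon>"
    using \<open>\<delta>1 > 0\<close> \<open>\<delta>2 > 0\<close> by (intro exI[of _ "min \<delta>1 \<delta>2"]) auto
qed

lemma abs_continuous_on_imp_continuous_on:
  assumes "abs_continuous_on {a..b} f"
  shows "continuous_on {a..b} f"
  unfolding continuous_on_iff
proof (intro ballI allI impI)
  fix s and \<epsilon> :: real assume s: "s \<in> {a..b}" and "\<epsilon> > 0"
  with assms(1) obtain \<delta> where "\<delta> > 0" and \<delta>: "\<And>I. finite I \<Longrightarrow> (\<forall>(u, v)\<in>I. u \<le> v \<and> {u..v} \<subseteq> {a..b}) \<Longrightarrow>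
      pairwise (\<lambda>(u, v) (u', v'). {u<..<v} \<inter> {u'<..<v'} = {}) I \<Longrightarrow>
      (\<Sum>(u, v)\<in>I. v - u) < \<delta> \<Longrightarrow> (\<Sum>(u, v)\<in>I. norm (f v - f u)) < \<epsilon>"
    unfolding abs_continuous_on_def by meson
  have "dist (f t) (f s) < \<epsilon>" if "t \<in> {a..b}" "dist t s < \<delta>" for t
    \<comment> \<open>The family consists of a single interval; \<open>min\<close> and
      \<open>max\<close> put its endpoints in order.\<close>
    using \<delta>[of "{(min s t, max s t)}"] s that
    by (cases "s \<le> t") (auto simp: dist_norm norm_minus_commute min_def max_def split: if_splits)
  then show "\<exists>\<delta>>0. \<forall>t\<in>{a..b}. dist t s < \<delta> \<longrightarrow> dist (f t) (f s) < \<epsilon>"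
    using \<open>\<delta> > 0\<close> by blast
qed

section \<open>Integrals of functions that need not be measurable\<close>

text \<open>The integral is a supremum over simple functions below \<open>f\<close>. Each of these
  is measurable, so its own integral splits exactly, whether or not \<open>f\<close> is measurable.
  This is meant for the integrand of \<open>cost\<close>, which contains a
  \<open>vector_derivative\<close>.\<close>

lemma nn_integral_split_le:
  assumes A: "A \<in> sets M"
  shows "(\<integral>\<^sup>+t. f t \<partial>M) \<le> (\<integral>\<^sup>+t\<in>A. f t \<partial>M) + (\<integral>\<^sup>+t\<in>-A. f t \<partial>M)"
  unfolding nn_integral_def[of M f]
proof (rule SUP_least, clarify)
  fix g assume g: "simple_function M g" "g \<le> f"
  have [measurable]: "g \<in> borel_measurable M" "A \<in> sets M"
    using g A by (auto intro: borel_measurable_simple_function)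
  have "integral\<^sup>S M g = (\<integral>\<^sup>+t. g t \<partial>M)"
    using g by (simp add: nn_integral_eq_simple_integral)
  also have "\<dots> = (\<integral>\<^sup>+t. g t * indicator A t + g t * indicator (space M - A) t \<partial>M)"
    by (intro nn_integral_cong) (auto simp: indicator_def)
  also have "\<dots> = (\<integral>\<^sup>+t\<in>A. g t \<partial>M) + (\<integral>\<^sup>+t\<in>space M - A. g t \<partial>M)"
    by (intro nn_integral_add) auto
  also have "\<dots> \<le> (\<integral>\<^sup>+t\<in>A. f t \<partial>M) + (\<integral>\<^sup>+t\<in>-A. f t \<partial>M)"
    using g(2) by (intro add_mono nn_integral_mono) (auto simp: indicator_def le_fun_def)
  finally show "integral\<^sup>S M g \<le> (\<integral>\<^sup>+t\<in>A. f t \<partial>M) + (\<integral>\<^sup>+t\<in>-A. f t \<partial>M)" .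
qed

text \<open>A simple function below the translate of \<open>f\<close> becomes, when translated back,
  a measurable function below \<open>f\<close> with the same integral.\<close>

lemma nn_integral_lebesgue_shift_le:
  fixes f :: "real \<Rightarrow> ennreal"
  shows "(\<integral>\<^sup>+t. f (t - c) \<partial>lebesgue) \<le> (\<integral>\<^sup>+t. f t \<partial>lebesgue)"
  unfolding nn_integral_def[of lebesgue "\<lambda>t. f (t - c)"]
proof (rule SUP_least, clarify)
  fix g :: "real \<Rightarrow> ennreal" assume g: "simple_function lebesgue g" "g \<le> (\<lambda>t. f (t - c))"
  have "integral\<^sup>S lebesgue g = (\<integral>\<^sup>+t. g t \<partial>lebesgue)"
    using g by (simp add: nn_integral_eq_simple_integral)
  \<comment> \<open>Affine substitution with slope 1, applied to the measurable \<open>g\<close>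
    only.\<close>
  also have "\<dots> = (\<integral>\<^sup>+t. g (c + t) \<partial>lebesgue)"
    using nn_integral_real_affine_lebesgue[of g 1 c] g by (simp add: borel_measurable_simple_function)
  also have "\<dots> \<le> (\<integral>\<^sup>+t. f t \<partial>lebesgue)"
    using g(2) by (intro nn_integral_mono) (auto simp: le_fun_def dest: spec[of _ "c + t" for t])
  finally show "integral\<^sup>S lebesgue g \<le> (\<integral>\<^sup>+t. f t \<partial>lebesgue)" .
qed

text \<open>\<open>lborel\<close> is its own image under translation, and passing to the completion
  does not change which properties hold almost everywhere.\<close>

lemma AE_lebesgue_shift:
  assumes "AE t in lebesgue. P t"
  shows "AE t in lebesgue. P (c + t :: real)"
proof -
  have "AE t in distr lborel borel ((+) c). P t"
    using assms unfolding lborel_distr_plus AE_completion_iff .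
  then have "AE t in lborel. P (c + t)"
    by (rule AE_distrD[rotated]) simp
  then show ?thesis by (rule AE_completion)
qed

lemma AE_lebesgue_neq: "AE t in lebesgue. t \<noteq> (c :: real)"
  by (rule AE_completion[OF AE_lborel_singleton])

section \<open>Trajectories\<close>

text \<open>The two endpoints form a null set, and at interior points the one-interval derivative is
  the ordinary one.\<close>

lemma AE_Icc_vector_derivative_iff:
  "(AE t\<in>{a..b} in lebesgue. \<exists>v\<in>G t. (f has_vector_derivative v) (at t within {a..b})) \<longleftrightarrow>
   (AE t\<in>{a<..<b} in lebesgue. \<exists>v\<in>G t. (f has_vector_derivative v) (at t))"
proof -
  have "AE t in lebesgue. (t \<in> {a..b} \<longrightarrow> (\<exists>v\<in>G t. (f has_vector_derivative v) (at t within {a..b}))) \<longleftrightarrow>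
      (t \<in> {a<..<b} \<longrightarrow> (\<exists>v\<in>G t. (f has_vector_derivative v) (at t)))"
    using AE_lebesgue_neq[of a] AE_lebesgue_neq[of b]
    by eventually_elim (auto simp: at_within_Icc_at)
  then show ?thesis by (rule eventually_cong) 
qed

text \<open>The integrands agree except possibly at the two endpoints.\<close>

lemma cost_eq_open:
  "cost \<psi> T \<pi> = (\<integral>\<^sup>+t\<in>{0<..<T}. ennreal (\<psi> (\<pi> t, vector_derivative \<pi> (at t))) \<partial>lebesgue)"
  unfolding cost_def
proof (rule nn_integral_cong_AE)
  show "AE t in lebesgue. ennreal (\<psi> (\<pi> t, vector_derivative \<pi> (at t within {0..T}))) * indicator {0..T} t =
      ennreal (\<psi> (\<pi> t, vector_derivative \<pi> (at t))) * indicator {0<..<T} t"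
    using AE_lebesgue_neq[of 0] AE_lebesgue_neq[of T]
    by eventually_elim (auto simp: at_within_Icc_at indicator_def)
qed

text \<open>The working form of the definition: two-sided derivatives are local, so they survive
  cutting and gluing without reference to the time domain.\<close>

lemma trajectories_iff:
  "(T, \<pi>) \<in> trajectories X F Ob x y \<longleftrightarrow>
     0 \<le> T \<and> (\<forall>t\<in>{0..T}. \<pi> t \<in> X) \<and> abs_continuous_on {0..T} \<pi> \<and>
     (AE t\<in>{0<..<T} in lebesgue. \<exists>v\<in>F (\<pi> t). (\<pi> has_vector_derivative v) (at t)) \<and>
     \<pi> 0 = x \<and> \<pi> T = y \<and> (\<forall>t\<in>{0..T}. \<pi> t \<in> closure (X - Ob))"
  unfolding trajectories_def mem_Collect_eq case_prod_conv AE_Icc_vector_derivative_iff ..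

section \<open>Restriction and concatenation of trajectories\<close>

lemma has_vector_derivative_shift:
  assumes "(f has_vector_derivative v) (at (t - c))"
  shows "((\<lambda>t. f (t - c)) has_vector_derivative v) (at t)"
proof -
  have "((\<lambda>t. t - c) has_vector_derivative 1) (at t)"
    by (auto intro!: derivative_eq_intros)
  from vector_diff_chain_at[OF this assms] show ?thesis by (simp add: o_def)
qed

text \<open>The piece over [s, t] is translated by \<open>s\<close> because trajectories start at
  time 0; the dynamics do not depend on time.\<close>

lemma trajectories_restrict:
  assumes "(T, \<pi>) \<in> trajectories X F Ob x y" "0 \<le> s" "s \<le> t" "t \<le> T"
  shows "(t - s, \<lambda>u. \<pi> (u + s)) \<in> trajectories X F Ob (\<pi> s) (\<pi> t)"
proof -
  from assms(1) have \<pi>: "\<forall>t\<in>{0..T}. \<pi> t \<in> X" "abs_continuous_on {0..T} \<pi>"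
    "AE t in lebesgue. t \<in> {0<..<T} \<longrightarrow> (\<exists>v\<in>F (\<pi> t). (\<pi> has_vector_derivative v) (at t))"
    "\<forall>t\<in>{0..T}. \<pi> t \<in> closure (X - Ob)"
    by (auto simp: trajectories_iff)
  have "abs_continuous_on {s..t} \<pi>"
    using assms by (intro abs_continuous_on_subset[OF \<pi>(2)]) auto
  from abs_continuous_on_shift[OF this, of "-s"] have ac: "abs_continuous_on {0..t - s} (\<lambda>u. \<pi> (u + s))"
    by simp
  have "AE u in lebesgue. u \<in> {0<..<t - s} \<longrightarrow>
      (\<exists>v\<in>F (\<pi> (u + s)). ((\<lambda>u. \<pi> (u + s)) has_vector_derivative v) (at u))"
    using AE_lebesgue_shift[OF \<pi>(3), of s]
  proof eventually_elim
    case (elim u)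
    then show ?case
      using assms has_vector_derivative_shift[of \<pi> _ u "-s"] by (auto simp: add.commute)
  qed
  then show ?thesis
    using assms \<pi>(1,4) ac by (auto simp: trajectories_iff)
qed

text \<open>At the junction \<open>a\<close> the value is taken from \<open>f\<close>; for curves
  that meet, it equals \<open>g 0\<close>, so either formula holds there.\<close>

definition concat_curve :: "real \<Rightarrow> (real \<Rightarrow> 'a) \<Rightarrow> (real \<Rightarrow> 'a) \<Rightarrow> real \<Rightarrow> 'a" where
  "concat_curve a f g t = (if t \<le> a then f t else g (t - a))"

lemma has_vector_derivative_concat_left:
  assumes "(f has_vector_derivative v) (at t)" "t < a"
  shows "(concat_curve a f g has_vector_derivative v) (at t)"
  by (rule has_vector_derivative_transform_within_open[OF assms(1), of "{..<a}"])
    (use assms in \<open>auto simp: concat_curve_def\<close>)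

lemma has_vector_derivative_concat_right:
  assumes "(g has_vector_derivative v) (at (t - a))" "a < t"
  shows "(concat_curve a f g has_vector_derivative v) (at t)"
  by (rule has_vector_derivative_transform_within_open
      [OF has_vector_derivative_shift[OF assms(1)], of "{a<..}"])
    (use assms in \<open>auto simp: concat_curve_def\<close>)

text \<open>The glued curve may have a kink at the junction, but that single time is negligible;
  elsewhere it coincides locally with one of the pieces.\<close>

lemma trajectories_concat:
  assumes f: "(a, f) \<in> trajectories X F Ob x y" and g: "(b, g) \<in> trajectories X F Ob y z"
  shows "(a + b, concat_curve a f g) \<in> trajectories X F Ob x z"
proof -
  let ?h = "concat_curve a f g"
  from f have f': "0 \<le> a" "\<forall>t\<in>{0..a}. f t \<in> X" "abs_continuous_on {0..a} f"
    "AE t in lebesgue. t \<in> {0<..<a} \<longrightarrow> (\<exists>v\<in>F (f t). (f has_vector_derivative v) (at t))"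
    "f 0 = x" "f a = y" "\<forall>t\<in>{0..a}. f t \<in> closure (X - Ob)"
    by (auto simp: trajectories_iff)
  from g have g': "0 \<le> b" "\<forall>t\<in>{0..b}. g t \<in> X" "abs_continuous_on {0..b} g"
    "AE t in lebesgue. t \<in> {0<..<b} \<longrightarrow> (\<exists>v\<in>F (g t). (g has_vector_derivative v) (at t))"
    "g 0 = y" "g b = z" "\<forall>t\<in>{0..b}. g t \<in> closure (X - Ob)"
    by (auto simp: trajectories_iff)
  have left: "?h t = f t" if "t \<le> a" for t
    using that by (simp add: concat_curve_def)
  \<comment> \<open>At \<open>t = a\<close> this uses that both curves pass through
    \<open>y\<close>.\<close>
  have right: "?h t = g (t - a)" if "a \<le> t" for t
    using that f'(6) g'(5) by (auto simp: concat_curve_def)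
  have "abs_continuous_on {0..a} ?h"
    by (rule abs_continuous_on_cong[OF f'(3)]) (simp add: left)
  moreover have "abs_continuous_on {a..a + b} ?h"
  proof (rule abs_continuous_on_cong)
    show "abs_continuous_on {a..a + b} (\<lambda>t. g (t - a))"
      using abs_continuous_on_shift[OF g'(3), of a] by (simp add: add.commute)
  qed (simp add: right)
  ultimately have ac: "abs_continuous_on {0..a + b} ?h"
    by (rule abs_continuous_on_join)
  have "AE t in lebesgue. t \<in> {0<..<a + b} \<longrightarrow> (\<exists>v\<in>F (?h t). (?h has_vector_derivative v) (at t))"
    using f'(4) AE_lebesgue_shift[OF g'(4), of "-a"] AE_lebesgue_neq[of a]
  proof eventually_elim
    case (elim t)
    show ?case
    proof
      assume t: "t \<in> {0<..<a + b}"
      consider "t < a" | "a < t" using elim(3) by linarith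
      then show "\<exists>v\<in>F (?h t). (?h has_vector_derivative v) (at t)"
      proof cases
        case 1
        then show ?thesis
          using elim(1) t by (auto simp: left intro: has_vector_derivative_concat_left)
      next
        case 2
        then show ?thesis
          using elim(2) t by (auto simp: right intro: has_vector_derivative_concat_right)
      qed
    qed
  qed
  moreover have "\<forall>t\<in>{0..a + b}. ?h t \<in> X" "\<forall>t\<in>{0..a + b}. ?h t \<in> closure (X - Ob)"
    using f' g' by (auto simp: concat_curve_def)
  ultimately show ?thesis
    using ac f'(1,5) g'(1,6) left[of 0] right[of "a + b"] by (auto simp: trajectories_iff)
qed

text \<open>Split the integral at time \<open>a\<close>: almost everywhere each half is dominated by
  the integrand of one piece, the second one translated by \<open>a\<close>.\<close>

lemma cost_concat_le:
  assumes f: "(a, f) \<in> trajectories X F Ob x y" and g: "(b, g) \<in> trajectories X F Ob y z"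
  shows "cost \<psi> (a + b) (concat_curve a f g) \<le> cost \<psi> a f + cost \<psi> b g"
proof -
  let ?h = "concat_curve a f g"
  define c :: "(real \<Rightarrow> 'a) \<Rightarrow> real \<Rightarrow> ennreal" where
    "c = (\<lambda>f t. ennreal (\<psi> (f t, vector_derivative f (at t))))"
  have cost: "cost \<psi> T \<pi> = (\<integral>\<^sup>+t. c \<pi> t * indicator {0<..<T} t \<partial>lebesgue)" for T \<pi>
    by (simp add: cost_eq_open c_def)
  have f': "0 \<le> a" "AE t in lebesgue. t \<in> {0<..<a} \<longrightarrow> (\<exists>v\<in>F (f t). (f has_vector_derivative v) (at t))"
    and g': "0 \<le> b" "AE t in lebesgue. t \<in> {0<..<b} \<longrightarrow> (\<exists>v\<in>F (g t). (g has_vector_derivative v) (at t))"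
    using f g by (auto simp: trajectories_iff)
  \<comment> \<open>The indicators leave at most the times in (0, a]; the junction
    \<open>t = a\<close> is discarded as a null set.\<close>
  have 1: "AE t in lebesgue. c ?h t * indicator {0<..<a + b} t * indicator {..a} t \<le> c f t * indicator {0<..<a} t"
    using f'(2) AE_lebesgue_neq[of a]
  proof eventually_elim
    case (elim t)
    show ?case
    proof (cases "t \<in> {0<..<a}")
      case True
      then obtain v where v: "(f has_vector_derivative v) (at t)" using elim by auto
      have "c ?h t = c f t"
        using True vector_derivative_at[OF v] vector_derivative_at[OF has_vector_derivative_concat_left[OF v]]
        by (simp add: c_def concat_curve_def)
      with True show ?thesis by (simp add: indicator_def)
    next
      case False
      then show ?thesis using elim by (auto simp: indicator_def)
    qed
  qed
  \<comment> \<open>Here the junction is already cut off, and \<open>t - a\<close> ranges exactly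
    over \<open>{0<..<b}\<close>.\<close>
  have 2: "AE t in lebesgue. c ?h t * indicator {0<..<a + b} t * indicator (- {..a}) t \<le>
      c g (t - a) * indicator {0<..<b} (t - a)"
    using AE_lebesgue_shift[OF g'(2), of "-a"]
  proof eventually_elim
    case (elim t)
    show ?case
    proof (cases "t - a \<in> {0<..<b}")
      case True
      then obtain v where v: "(g has_vector_derivative v) (at (t - a))" using elim by auto
      have "c ?h t = c g (t - a)"
        using True vector_derivative_at[OF v] vector_derivative_at[OF has_vector_derivative_concat_right[OF v]]
        by (simp add: c_def concat_curve_def)
      with True show ?thesis by (simp add: indicator_def)
    next
      case False
      then show ?thesis by (auto simp: indicator_def)
    qed
  qed
  have "cost \<psi> (a + b) ?h \<le>
      (\<integral>\<^sup>+t. c ?h t * indicator {0<..<a + b} t * indicator {..a} t \<partial>lebesgue) +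
      (\<integral>\<^sup>+t. c ?h t * indicator {0<..<a + b} t * indicator (- {..a}) t \<partial>lebesgue)"
    unfolding cost by (rule nn_integral_split_le) simp
  also have "\<dots> \<le> cost \<psi> a f + (\<integral>\<^sup>+t. c g (t - a) * indicator {0<..<b} (t - a) \<partial>lebesgue)"
    unfolding cost by (intro add_mono nn_integral_mono_AE 1 2)
  also have "\<dots> \<le> cost \<psi> a f + cost \<psi> b g"
    unfolding cost
    by (intro add_left_mono nn_integral_lebesgue_shift_le[of "\<lambda>t. c g t * indicator {0<..<b} t"])
  finally show ?thesis .
qed

section \<open>Bounds on the cost\<close>

text \<open>At almost every time \<open>vector_derivative\<close> is an admissible velocity, so
  \<open>M\<close> bounds the integrand over a time interval of length \<open>T\<close>.\<close>

lemma cost_le: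
  assumes \<pi>: "(T, \<pi>) \<in> trajectories X F Ob x y"
    and M: "\<And>t v. t \<in> {0..T} \<Longrightarrow> v \<in> F (\<pi> t) \<Longrightarrow> \<psi> (\<pi> t, v) \<le> M" and "0 \<le> M"
  shows "cost \<psi> T \<pi> \<le> ennreal (M * T)"
proof -
  have T: "0 \<le> T" and
    ae: "AE t in lebesgue. t \<in> {0<..<T} \<longrightarrow> (\<exists>v\<in>F (\<pi> t). (\<pi> has_vector_derivative v) (at t))"
    using \<pi> by (auto simp: trajectories_iff)
  have "cost \<psi> T \<pi> \<le> (\<integral>\<^sup>+t. ennreal M * indicator {0<..<T} t \<partial>lebesgue)"
    unfolding cost_eq_open using ae
  proof (rule nn_integral_mono_AE[OF AE_mp], intro AE_I2 impI)
    fix t assume t: "t \<in> {0<..<T} \<longrightarrow> (\<exists>v\<in>F (\<pi> t). (\<pi> has_vector_derivative v) (at t))"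
    show "ennreal (\<psi> (\<pi> t, vector_derivative \<pi> (at t))) * indicator {0<..<T} t \<le> ennreal M * indicator {0<..<T} t"
    proof (cases "t \<in> {0<..<T}")
      case True
      then obtain v where "v \<in> F (\<pi> t)" "(\<pi> has_vector_derivative v) (at t)" using t by auto
      then have "\<psi> (\<pi> t, vector_derivative \<pi> (at t)) \<le> M"
        using M[of t v] True by (simp add: vector_derivative_at)
      then show ?thesis by (simp add: indicator_def ennreal_leI)
    qed simp
  qed
  also have "\<dots> = ennreal (M * T)"
    using T \<open>0 \<le> M\<close> by (simp add: nn_integral_cmult_indicator ennreal_mult)
  finally show ?thesis .
qed

text \<open>The curve is continuous on a compact interval, so its image is compact and
  \<open>SH1\<close> bounds the velocities there. A continuous \<psi> is then bounded on the
  resulting compact set of positions and velocities.\<close>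

lemma trajectory_running_cost_bounded:
  fixes \<psi> :: "'a::euclidean_space \<times> 'a \<Rightarrow> real"
  assumes "subspace X" "\<And>x. x \<in> X \<Longrightarrow> F x \<subseteq> X" "SH1 X F" "continuous_on (X \<times> X) \<psi>"
    and \<pi>: "(T, \<pi>) \<in> trajectories X F Ob x y"
  obtains M where "0 \<le> M" "\<And>t v. t \<in> {0..T} \<Longrightarrow> v \<in> F (\<pi> t) \<Longrightarrow> \<psi> (\<pi> t, v) \<le> M"
proof -
  let ?K = "\<pi> ` {0..T}"
  have in_X: "?K \<subseteq> X" and "abs_continuous_on {0..T} \<pi>"
    using \<pi> by (auto simp: trajectories_iff)
  then have K: "compact ?K"
    by (intro compact_continuous_image abs_continuous_on_imp_continuous_on) auto
  with in_X \<open>SH1 X F\<close> obtain B where B: "\<And>x v. x \<in> ?K \<Longrightarrow> v \<in> F x \<Longrightarrow> norm v \<le> B"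
    unfolding SH1_def by meson
  have "closed X" using \<open>subspace X\<close> by (rule closed_subspace)
  \<comment> \<open>The ball is cut down to the closed set \<open>X\<close> because continuity of
    \<psi> is given on \<open>X \<times> X\<close> only.\<close>
  then have "compact (?K \<times> (cball 0 B \<inter> X))"
    using K by (intro compact_Times compact_Int_closed) auto
  then have "compact (\<psi> ` (?K \<times> (cball 0 B \<inter> X)))"
    using in_X by (intro compact_continuous_image continuous_on_subset[OF assms(4)]) auto
  then have "bounded (\<psi> ` (?K \<times> (cball 0 B \<inter> X)))"
    by (rule compact_imp_bounded)
  then obtain M where M: "\<forall>p \<in> ?K \<times> (cball 0 B \<inter> X). norm (\<psi> p) \<le> M"
    unfolding bounded_iff ball_simps by (rule exE)
  show thesis
  \<comment> \<open>The absolute value supplies nonnegativity.\<close>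
  proof (rule that[of "\<bar>M\<bar>"])
    fix t v assume "t \<in> {0..T}" "v \<in> F (\<pi> t)"
    then have "(\<pi> t, v) \<in> ?K \<times> (cball 0 B \<inter> X)"
      using B[of "\<pi> t" v] assms(2)[of "\<pi> t"] in_X by (auto simp: image_subset_iff)
    with M have "norm (\<psi> (\<pi> t, v)) \<le> M" by (rule bspec)
    then show "\<psi> (\<pi> t, v) \<le> \<bar>M\<bar>" by simp
  qed simp
qed

section \<open>Clearance\<close>

text \<open>A triangle inequality: any trajectory from \<open>y\<close> to the obstacle, preceded by
  \<open>f\<close>, competes in the clearance of \<open>x\<close>.\<close>

lemma clearance_le_cost_add:
  assumes f: "(a, f) \<in> trajectories X F Ob x y" and fin: "cost \<psi> a f \<noteq> \<infinity>"
  shows "clearance X F \<psi> Ob x \<le> cost \<psi> a f + clearance X F \<psi> Ob y"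
proof -
  \<comment> \<open>With the cost moved to the left, the claim is a lower bound for an infimum and
    can be checked on each competitor. Finiteness of the cost makes the move reversible in
    \<open>ennreal\<close>.\<close>
  have "clearance X F \<psi> Ob x - cost \<psi> a f \<le> clearance X F \<psi> Ob y"
    unfolding clearance_def[of _ _ _ _ y] cost_dist_def
  proof (intro INF_greatest, clarify)
    fix z b g assume z: "z \<in> Ob" and g: "(b, g) \<in> trajectories X F Ob y z"
    have "clearance X F \<psi> Ob x \<le> cost_dist X F \<psi> Ob x z"
      unfolding clearance_def using z by (rule INF_lower)
    also have "\<dots> \<le> cost \<psi> (a + b) (concat_curve a f g)"
      unfolding cost_dist_def using INF_lower[OF trajectories_concat[OF f g], of "\<lambda>(T, \<pi>). cost \<psi> T \<pi>"] by simp
    also have "\<dots> \<le> cost \<psi> a f + cost \<psi> b g"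
      by (rule cost_concat_le[OF f g])
    finally show "clearance X F \<psi> Ob x - cost \<psi> a f \<le> cost \<psi> b g"
      using fin by (auto simp: ennreal_minus_le_iff)
  qed
  then show ?thesis
    using fin by (auto simp: ennreal_minus_le_iff)
qed

section \<open>One-sided limits of monotone functions\<close>

text \<open>The limit is the supremum over the times before \<open>c\<close>; it exists in any
  complete linear order, so infinite values are allowed.\<close>

lemma mono_on_tendsto_at_left:
  fixes f :: "real \<Rightarrow> 'b::{complete_linorder, linorder_topology}"
  assumes mono: "mono_on {a<..c} f" and "a < c"
  obtains L where "(f \<longlongrightarrow> L) (at_left c)" "L \<le> f c"
proof (rule that)
  let ?L = "SUP t\<in>{a<..<c}. f t"
  show "(f \<longlongrightarrow> ?L) (at_left c)"
  proof (rule order_tendstoI)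
    fix l assume "l < ?L"
    then obtain s where s: "s \<in> {a<..<c}" "l < f s" by (auto simp: less_SUP_iff)
    have "eventually (\<lambda>t. t \<in> {s<..<c}) (at_left c)"
      using s by (intro eventually_at_left_real) auto
    then show "eventually (\<lambda>t. l < f t) (at_left c)"
    proof eventually_elim
      case (elim t)
      then have "f s \<le> f t" using s by (intro mono_onD[OF mono]) auto
      with s show ?case by simp
    qed
  next
    fix u assume "?L < u"
    have "eventually (\<lambda>t. t \<in> {a<..<c}) (at_left c)"
      using \<open>a < c\<close> by (rule eventually_at_left_real)
    then show "eventually (\<lambda>t. f t < u) (at_left c)"
    proof eventually_elim
      case (elim t)
      then have "f t \<le> ?L" by (rule SUP_upper)
      then show ?case using \<open>?L < u\<close> by (rule le_less_trans)
    qed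
  qed
  show "?L \<le> f c"
    by (intro SUP_least mono_onD[OF mono]) (use \<open>a < c\<close> in auto)
qed

text \<open>Dually, the limit is the infimum over the times after \<open>c\<close>.\<close>

lemma mono_on_tendsto_at_right:
  fixes f :: "real \<Rightarrow> 'b::{complete_linorder, linorder_topology}"
  assumes mono: "mono_on {c..<b} f" and "c < b"
  obtains R where "(f \<longlongrightarrow> R) (at_right c)" "f c \<le> R"
proof (rule that)
  let ?R = "INF t\<in>{c<..<b}. f t"
  show "(f \<longlongrightarrow> ?R) (at_right c)"
  proof (rule order_tendstoI)
    fix u assume "?R < u"
    then obtain s where s: "s \<in> {c<..<b}" "f s < u" by (auto simp: INF_less_iff)
    have "eventually (\<lambda>t. t \<in> {c<..<s}) (at_right c)"
      using s by (intro eventually_at_right_real) auto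
    then show "eventually (\<lambda>t. f t < u) (at_right c)"
    proof eventually_elim
      case (elim t)
      then have "f t \<le> f s" using s by (intro mono_onD[OF mono]) auto
      with s show ?case by simp
    qed
  next
    fix l assume "l < ?R"
    have "eventually (\<lambda>t. t \<in> {c<..<b}) (at_right c)"
      using \<open>c < b\<close> by (rule eventually_at_right_real)
    then show "eventually (\<lambda>t. l < f t) (at_right c)"
    proof eventually_elim
      case (elim t)
      then have "?R \<le> f t" by (rule INF_lower)
      with \<open>l < ?R\<close> show ?case by (rule less_le_trans)
    qed
  qed
  show "f c \<le> ?R"
    by (intro INF_greatest mono_onD[OF mono]) (use \<open>c < b\<close> in auto)
qed

theorem theorem4p4:
  fixes X Ob :: "'a::euclidean_space set"
    and F :: "'a \<Rightarrow> 'a set"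
    and \<psi> :: "'a \<times> 'a \<Rightarrow> real"
    and \<pi> :: "real \<Rightarrow> 'a"
    and T \<tau> :: real
    and x y :: 'a
  assumes "subspace X"
    and "\<And>x. x \<in> X \<Longrightarrow> F x \<subseteq> X"
    and "SH1 X F" and "SH2 X F" and "SH3 X F"
    and "continuous_on (X \<times> X) \<psi>"
    and "\<And>x v. x \<in> X \<Longrightarrow> v \<in> X \<Longrightarrow> 0 < \<psi> (x, v)"
    and "closed Ob" and "Ob \<subseteq> X"
    and "x \<in> X" and "y \<in> X"
    and "(T, \<pi>) \<in> trajectories X F Ob x y"
    and "0 < \<tau>" and "\<tau> < T"
    and "clearance X F \<psi> Ob (\<pi> \<tau>) < \<infinity>"
  shows "\<exists>L R :: ennreal.
           ((\<lambda>t. clearance X F \<psi> Ob (\<pi> t)) \<longlongrightarrow> L) (at_left \<tau>) \<and>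
           ((\<lambda>t. clearance X F \<psi> Ob (\<pi> t)) \<longlongrightarrow> R) (at_right \<tau>) \<and>
           L \<le> clearance X F \<psi> Ob (\<pi> \<tau>) \<and>
           clearance X F \<psi> Ob (\<pi> \<tau>) \<le> R"
proof -
  let ?g = "\<lambda>t. clearance X F \<psi> Ob (\<pi> t)"
  note \<pi> = assms(12)
  obtain M where "0 \<le> M" and M: "\<And>t v. t \<in> {0..T} \<Longrightarrow> v \<in> F (\<pi> t) \<Longrightarrow> \<psi> (\<pi> t, v) \<le> M"
    using trajectory_running_cost_bounded[OF assms(1-3,6) \<pi>] by blast
  define h where "h = (\<lambda>t. ?g t + ennreal (M * t))"
  \<comment> \<open>The subtracted term is finite, so it cancels even where the clearance is
    infinite.\<close>
  have g_eq: "?g t = h t - ennreal (M * t)" for t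
    by (simp add: h_def)
  have mono: "mono_on {0..T} h"
  proof (rule mono_onI)
    fix s t assume st: "s \<in> {0..T}" "t \<in> {0..T}" "s \<le> t"
    let ?\<sigma> = "\<lambda>u. \<pi> (u + s)"
    have \<sigma>: "(t - s, ?\<sigma>) \<in> trajectories X F Ob (\<pi> s) (\<pi> t)"
      using st by (intro trajectories_restrict[OF \<pi>]) auto
    have c: "cost \<psi> (t - s) ?\<sigma> \<le> ennreal (M * (t - s))"
      by (rule cost_le[OF \<sigma>]) (use st M \<open>0 \<le> M\<close> in auto)
    then have "cost \<psi> (t - s) ?\<sigma> \<noteq> \<infinity>"
      by (auto simp: top_unique)
    from clearance_le_cost_add[OF \<sigma> this] c have "?g s \<le> ennreal (M * (t - s)) + ?g t"
      by (meson add_right_mono order_trans)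
    then have "h s \<le> ?g t + (ennreal (M * (t - s)) + ennreal (M * s))"
      unfolding h_def by (metis add.assoc add.commute add_right_mono)
    \<comment> \<open>Both arguments are nonnegative, so \<open>ennreal\<close> is additive on
      them.\<close>
    also have "ennreal (M * (t - s)) + ennreal (M * s) = ennreal (M * t)"
      using st \<open>0 \<le> M\<close> by (simp add: right_diff_distrib mult_left_mono flip: ennreal_plus)
    also have "?g t + ennreal (M * t) = h t"
      by (simp add: h_def)
    finally show "h s \<le> h t" .
  qed
  have lim: "((\<lambda>t. ennreal (M * t)) \<longlongrightarrow> ennreal (M * \<tau>)) (at \<tau> within A)" for A
    by (intro tendsto_intros)
  obtain L where L: "(h \<longlongrightarrow> L) (at_left \<tau>)" "L \<le> h \<tau>"
    by (rule mono_on_tendsto_at_left[of 0 \<tau> h])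
      (use assms(13,14) in \<open>auto intro: mono_on_subset[OF mono]\<close>)
  obtain R where R: "(h \<longlongrightarrow> R) (at_right \<tau>)" "h \<tau> \<le> R"
    by (rule mono_on_tendsto_at_right[of \<tau> T h])
      (use assms(13,14) in \<open>auto intro: mono_on_subset[OF mono]\<close>)
  \<comment> \<open>Subtracting the continuous finite term from \<open>h\<close> carries limits and
    inequalities back to the clearance. Its finiteness rules out \<infinity> - \<infinity>, even if
    \<open>L\<close> or \<open>R\<close> is infinite.\<close>
  show ?thesis
    unfolding g_eq
    by (intro exI[of _ "L - ennreal (M * \<tau>)"] exI[of _ "R - ennreal (M * \<tau>)"] conjI
        tendsto_diff_ennreal_general L R lim ennreal_minus_mono order_refl) auto
qed

end
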